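(* Let $S$ be a square in the Euclidean plane with a packing $\mathcal{P}$ of boxes, let $I=[a,b]$ be a closed real interval, let $t\in\mathbb{N}$, and let $f_k:I\to S$, for $1\le k\le t$, be a collection of continuous mappings. Suppose that: 1. for each $i\in I$, the set $F_i=\{f_k(i)\mid 1\le k\le t\}$ is an unavoidable set of points (in $S$); 2. if for some $1\le k\le t$ the point $f_k(a)$ is not contained in a box of $\mathcal{P}$, then $f_k(i)=f_k(a)$ for all $i\in I$; 3. if for some $1\le k,l\le t$ with $k\ne l$ the points $f_k(a)$ and $f_l(a)$ lie in the same box of $\mathcal{P}$, then $f_k(i)=f_k(a)$ for all $i\in I$. Then for all $1\le k\le t$, the image $f_k(I)$ either lies entirely within one box of $\mathcal{P}$, or lies completely outside any box of $\mathcal{P}$ (that is, it is disjoint from every box of $\mathcal{P}$).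
   Context: A box is the interior of any square in the Euclidean plane (in arbitrary position and orientation) with side length $s$ satisfying $1<s\le 1.01$; in particular boxes are open sets. A packing $\mathcal{P}$ of boxes in a (closed) square $S$ is a collection of pairwise disjoint boxes, each contained in $S$. A set of points $P\subset S$ is called unavoidable if every box $B\subseteq S$ contains one of the points in $P$. *)

theory Defs
  imports "HOL-Analysis.Analysis" "HOL-Library.Disjoint_Sets"
begin

text \<open>A closed square of side length \<open>s > 0\<close>, in arbitrary position and orientation:
  \<open>p\<close> is a corner and \<open>u\<close>, \<open>v\<close> are the orthonormal directions of the two sides at \<open>p\<close>.\<close>

definition square_of_side :: "real \<Rightarrow> (real^2) set \<Rightarrow> bool" where
  "square_of_side s Q \<longleftrightarrow> s > 0 \<and>
     (\<exists>p u v. norm u = 1 \<and> norm v = 1 \<and> u \<bullet> v = 0 \<and>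
        Q = {p + x *\<^sub>R u + y *\<^sub>R v | x y. x \<in> {0..s} \<and> y \<in> {0..s}})"

definition is_square :: "(real^2) set \<Rightarrow> bool" where
  "is_square Q \<longleftrightarrow> (\<exists>s. square_of_side s Q)"

text \<open>Not to be confused with the open coordinate intervals \<^const>\<open>box\<close> of the library.\<close>

definition is_box :: "(real^2) set \<Rightarrow> bool" where
  "is_box B \<longleftrightarrow> (\<exists>s Q. 1 < s \<and> s \<le> 1.01 \<and> square_of_side s Q \<and> B = interior Q)"

definition box_packing :: "(real^2) set set \<Rightarrow> (real^2) set \<Rightarrow> bool" where
  "box_packing \<P> S \<longleftrightarrow> (\<forall>B\<in>\<P>. is_box B \<and> B \<subseteq> S) \<and> disjoint \<P>"

definition unavoidable :: "(real^2) set \<Rightarrow> (real^2) set \<Rightarrow> bool" where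
  "unavoidable P S \<longleftrightarrow> P \<subseteq> S \<and> (\<forall>B. is_box B \<and> B \<subseteq> S \<longrightarrow> (\<exists>x\<in>P. x \<in> B))"

end

theory Submission
  imports Defs
begin

text \<open>
  The idea is to look at the first moment \<open>c\<close> at which some point escapes from the box \<open>B\<close> in
  which it started (\<open>first_exit_time\<close>). Boxes are open, so at time \<open>c\<close> the escaping point is
  already outside \<open>B\<close>. The set of points is still unavoidable, hence \<open>B\<close> contains some other
  point at time \<open>c\<close>, and there is nowhere this point can have come from. It did not start outside
  all boxes, as it would then never move. It did not start in \<open>B\<close>, as the escaping point would
  then share its box and be immobile. And if it started in another box \<open>B'\<close>, then it stayed in
  \<open>B'\<close> before time \<open>c\<close>, so by continuity it is at time \<open>c\<close> in the closure of \<open>B'\<close>, which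
  does not meet the open set \<open>B\<close> (\<open>path_end_avoids_disjoint_open\<close>).
\<close>

text \<open>
  Taking the minimum over all paths together, rather than one path at a time, gives control over
  every path before time \<open>c\<close>. It is attained because the exit times of a path from an open set
  form a closed set.
\<close>

lemma first_exit_time:
  fixes f :: "'k \<Rightarrow> real \<Rightarrow> 'a::topological_space"
  assumes "finite K"
    and cont: "\<And>k. k \<in> K \<Longrightarrow> continuous_on {a..b} (f k)"
    and opn: "\<And>k. k \<in> K \<Longrightarrow> open (U k)"
    and exit: "k \<in> K" "i \<in> {a..b}" "f k i \<notin> U k"
  obtains c l where "c \<in> {a..b}" "l \<in> K" "f l c \<notin> U l"
    "\<forall>j\<in>K. \<forall>i\<in>{a..<c}. f j i \<in> U j"
proof -
  define T where "T = (\<Union>k\<in>K. {a..b} \<inter> f k -` (- U k))"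
  have "compact ({a..b} \<inter> f k -` (- U k))" if "k \<in> K" for k
  proof -
    have "closed ({a..b} \<inter> f k -` (- U k))"
      by (rule continuous_closed_preimage[OF cont[OF that]]) (use opn[OF that] in auto)
    then have "compact ({a..b} \<inter> ({a..b} \<inter> f k -` (- U k)))"
      by (rule compact_Int_closed[OF compact_Icc])
    then show ?thesis
      by (simp only: Int_left_absorb)
  qed
  then have "compact T"
    unfolding T_def using \<open>finite K\<close> by (intro compact_UN) auto
  moreover have "T \<noteq> {}"
    using exit unfolding T_def by blast
  ultimately obtain c where c: "c \<in> T" "\<And>i. i \<in> T \<Longrightarrow> c \<le> i"
    using compact_attains_inf[of T] by auto
  then obtain l where l: "l \<in> K" "c \<in> {a..b}" "f l c \<notin> U l"
    unfolding T_def by auto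
  have "f j i \<in> U j" if "j \<in> K" "i \<in> {a..<c}" for j i
  proof (rule ccontr)
    assume "f j i \<notin> U j"
    then have "i \<in> T"
      using that l(2) unfolding T_def by auto
    then show False
      using c(2)[of i] that(2) by simp
  qed
  then show thesis
    using that[OF l(2,1,3)] by simp
qed

lemma path_end_avoids_disjoint_open:
  fixes g :: "real \<Rightarrow> 'a::topological_space"
  assumes "continuous_on {a..c} g" "a \<le> c" "g a \<in> U"
    and stay: "\<And>i. i \<in> {a..<c} \<Longrightarrow> g i \<in> U"
    and "open V" "U \<inter> V = {}"
  shows "g c \<notin> V"
proof (cases "a = c")
  \<comment> \<open>Here \<open>{a..<c}\<close> is empty, so the limit argument says nothing.\<close>
  case True
  then show ?thesis using assms by auto
next
  case False
  then have cl: "closure {a..<c} = {a..c}"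
    using \<open>a \<le> c\<close> by (intro closure_atLeastLessThan) auto
  have "g ` closure {a..<c} \<subseteq> closure U"
  proof (rule image_closure_subset)
    show "continuous_on (closure {a..<c}) g"
      using assms(1) cl by simp
    show "g ` {a..<c} \<subseteq> closure U"
      using stay closure_subset by blast
  qed simp
  then have "g c \<in> closure U"
    using cl \<open>a \<le> c\<close> by auto
  then show ?thesis
    using open_Int_closure_eq_empty[OF \<open>open V\<close>, of U] \<open>U \<inter> V = {}\<close> by blast
qed

lemma open_is_box: "is_box B \<Longrightarrow> open B"
  unfolding is_box_def by auto

theorem theorem8:
  fixes S :: "(real^2) set" and \<P> :: "(real^2) set set"
    and a b :: real and t :: nat and f :: "nat \<Rightarrow> real \<Rightarrow> real^2"
  assumes "is_square S"
    and "box_packing \<P> S"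
    and "a \<le> b"
    and "\<forall>k\<in>{1..t}. continuous_on {a..b} (f k) \<and> f k ` {a..b} \<subseteq> S"
    and "\<forall>i\<in>{a..b}. unavoidable {f k i | k. k \<in> {1..t}} S"
    and "\<forall>k\<in>{1..t}. (\<forall>B\<in>\<P>. f k a \<notin> B) \<longrightarrow> (\<forall>i\<in>{a..b}. f k i = f k a)"
    and "\<forall>k\<in>{1..t}. \<forall>l\<in>{1..t}. k \<noteq> l \<and> (\<exists>B\<in>\<P>. f k a \<in> B \<and> f l a \<in> B)
           \<longrightarrow> (\<forall>i\<in>{a..b}. f k i = f k a)"
  shows "\<forall>k\<in>{1..t}. (\<exists>B\<in>\<P>. f k ` {a..b} \<subseteq> B) \<or> (\<forall>B\<in>\<P>. f k ` {a..b} \<inter> B = {})"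
proof -
  note cont = assms(4) and unav = assms(5) and outside = assms(6) and shared = assms(7)
  have P_open: "open B" and P_box: "is_box B" "B \<subseteq> S" if "B \<in> \<P>" for B
    using assms(2) that open_is_box unfolding box_packing_def by auto
  have P_disj: "B \<inter> B' = {}" if "B \<in> \<P>" "B' \<in> \<P>" "B \<noteq> B'" for B B'
    using assms(2) that unfolding box_packing_def by (auto dest: disjointD)
  \<comment> \<open>Condition 2 makes every point with index outside \<open>K\<close> immobile.\<close>
  define K where "K = {k\<in>{1..t}. \<exists>B\<in>\<P>. f k a \<in> B}"
  define U where "U k = (SOME B. B \<in> \<P> \<and> f k a \<in> B)" for k
  have U: "U k \<in> \<P>" "f k a \<in> U k" if "k \<in> K" for k
    using someI_ex[of "\<lambda>B. B \<in> \<P> \<and> f k a \<in> B"] that unfolding K_def U_def by auto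
  have stays: "f k i \<in> U k" if k: "k \<in> K" and i: "i \<in> {a..b}" for k i
  proof (rule ccontr)
    assume exits: "f k i \<notin> U k"
    have fin: "finite K"
      unfolding K_def by simp
    have K_cont: "continuous_on {a..b} (f j)" if "j \<in> K" for j
      using cont that unfolding K_def by blast
    have U_open: "open (U j)" if "j \<in> K" for j
      using P_open U(1) that by blast
    obtain c k where c: "c \<in> {a..b}" and k: "k \<in> K" and esc: "f k c \<notin> U k"
      and before: "\<forall>j\<in>K. \<forall>i\<in>{a..<c}. f j i \<in> U j"
      by (rule first_exit_time[where f = f and U = U, OF fin K_cont U_open k i exits])
    have "unavoidable {f k c | k. k \<in> {1..t}} S"
      using unav c by (rule bspec)
    then have "\<exists>x\<in>{f k c | k. k \<in> {1..t}}. x \<in> U k"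
      using P_box[OF U(1)[OF k]] unfolding unavoidable_def by simp
    \<comment> \<open>This point \<open>l\<close> would have had to enter the box that \<open>k\<close> left.\<close>
    then obtain l where l: "l \<in> {1..t}" "f l c \<in> U k"
      by auto
    have "l \<in> K"
    proof (rule ccontr)
      assume "l \<notin> K"
      then have start: "\<forall>B\<in>\<P>. f l a \<notin> B"
        using l(1) unfolding K_def by blast
      then have "f l c = f l a"
        using outside l(1) c by blast
      then show False
        using l(2) start U(1)[OF k] by metis
    qed
    show False
    proof (cases "U l = U k")
      \<comment> \<open>Condition 3 pins the escaping point \<open>k\<close>, not just \<open>l\<close>.\<close>
      case True
      have "l \<noteq> k"
        using l(2) esc by auto
      have "f l a \<in> U k"
        using U(2)[OF \<open>l \<in> K\<close>] True by simp
      then have meet: "\<exists>B\<in>\<P>. f k a \<in> B \<and> f l a \<in> B"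
        using U[OF k] by (intro bexI[of _ "U k"]) simp_all
      have "k \<in> {1..t}"
        using k unfolding K_def by simp
      then have "\<forall>i\<in>{a..b}. f k i = f k a"
        by (rule shared[THEN bspec, THEN bspec, THEN mp, OF _ l(1)])
          (use meet \<open>l \<noteq> k\<close> in simp)
      then have "f k c = f k a"
        using c by (rule bspec)
      then show False
        using esc U(2)[OF k] by simp
    next
      case False
      have "continuous_on {a..c} (f l)"
        by (rule continuous_on_subset[OF K_cont[OF \<open>l \<in> K\<close>]]) (use c in auto)
      then have "f l c \<notin> U k"
      proof (rule path_end_avoids_disjoint_open)
        show "a \<le> c" using c by simp
        show "U l \<inter> U k = {}"
          using P_disj U(1) \<open>l \<in> K\<close> k False by blast
        show "f l i \<in> U l" if "i \<in> {a..<c}" for i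
          using before \<open>l \<in> K\<close> that by simp
        show "open (U k)"
          using P_open[OF U(1)[OF k]] .
      qed (rule U(2)[OF \<open>l \<in> K\<close>])
      then show False
        using l(2) by simp
    qed
  qed
  show ?thesis
  proof
    fix k assume k: "k \<in> {1..t}"
    show "(\<exists>B\<in>\<P>. f k ` {a..b} \<subseteq> B) \<or> (\<forall>B\<in>\<P>. f k ` {a..b} \<inter> B = {})"
    proof (cases "k \<in> K")
      case True
      then have "f k ` {a..b} \<subseteq> U k"
        using stays by (intro image_subsetI) simp
      then show ?thesis
        using U(1)[OF True] by (intro disjI1 bexI)
    next
      case False
      then have start: "\<forall>B\<in>\<P>. f k a \<notin> B"
        using k unfolding K_def by simp
      have "f k i = f k a" if "i \<in> {a..b}" for i
        by (rule outside[THEN bspec, THEN mp, THEN bspec, OF k start that])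
      then have still: "f k ` {a..b} \<subseteq> {f k a}"
        by (intro image_subsetI) (metis singletonI)
      have "f k ` {a..b} \<inter> B = {}" if "B \<in> \<P>" for B
      proof -
        have "f k a \<notin> B"
          by (rule start[THEN bspec, OF that])
        then have "{f k a} \<inter> B = {}"
          by simp
        then show ?thesis
          using Int_mono[OF still order_refl, of B] by (simp only: subset_empty)
      qed
      then show ?thesis
        by (intro disjI2 ballI)
    qed
  qed
qed

end
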